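(* Let $n\ge2$. For general $a_0,\ldots,a_{n+1},b_0,\ldots,b_{n+1}\in\mathbb C$ the number of complex solutions $(u,v)\in\mathbb C^2$ of the system of polynomial equations $$\begin{aligned}a_0+a_1u+a_2v+a_3u(u^2+v^2)+\cdots+a_{n+1}u(u^2+v^2)^{n-1}&=0,\\ b_0+b_1u+b_2v+b_3v(u^2+v^2)+\cdots+b_{n+1}v(u^2+v^2)^{n-1}&=0\end{aligned}$$ is $4n-3$. This also holds if $a_0,\ldots,b_{n+1}$ are determined by a general choice of the parameters $\omega_0,\omega,\lambda,\gamma,\alpha_1,\ldots,\alpha_{n-1}$ through $$a_0=b_0=0,\quad a_1=\tfrac{\omega_0^2-\omega^2}{2}-\tfrac{\lambda\omega_0^2}{4},\quad b_2=\tfrac{\omega_0^2-\omega^2}{2}+\tfrac{\lambda\omega_0^2}{4},\quad a_2=-b_1=\tfrac{\gamma\omega}{2},$$ $$a_{k+2}=b_{k+2}=\frac{\alpha_k}{2^{2k+1}}\binom{2k+1}{k},\qquad k=1,\ldots,n-1.$$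
   Context: "General" means: outside a proper algebraic subvariety of the space of the coefficients (respectively of the parameters). The parameters come from Harmonic Balance equations for a driven nonlinear resonator with nonlinearity of degree $2n-1\ge3$. *)

theory Defs
  imports Complex_Main "HOL-Library.FuncSet" "HOL-Library.Poly_Mapping"
begin

text \<open>
  A polynomial over the complex numbers in variables of type \<^typ>\<open>'v\<close> is a finitely supported
  map from monomials to coefficients, a monomial being a finitely supported map from variables
  to exponents.
\<close>

type_synonym 'v cpoly = "('v \<Rightarrow>\<^sub>0 nat) \<Rightarrow>\<^sub>0 complex"

definition cpoly_vars :: "'v cpoly \<Rightarrow> 'v set" where
  "cpoly_vars p = (\<Union>m\<in>Poly_Mapping.keys p. Poly_Mapping.keys m)"

definition cpoly_eval :: "('v \<Rightarrow> complex) \<Rightarrow> 'v cpoly \<Rightarrow> complex" where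
  "cpoly_eval x p =
     (\<Sum>m\<in>Poly_Mapping.keys p. Poly_Mapping.lookup p m *
        (\<Prod>v\<in>Poly_Mapping.keys m. x v ^ Poly_Mapping.lookup m v))"

text \<open>The points of the affine space with coordinates indexed by \<open>I\<close> are extensional functions
  (they take the value \<^term>\<open>undefined\<close> outside \<open>I\<close>), so that a point is exactly a family of
  complex numbers indexed by \<open>I\<close>.\<close>

definition affine_space :: "'v set \<Rightarrow> ('v \<Rightarrow> complex) set" where
  "affine_space I = (I \<rightarrow>\<^sub>E UNIV)"

text \<open>Subvarieties are Zariski closed subsets; they need not be irreducible.\<close>

definition algebraic_subvariety :: "'v set \<Rightarrow> ('v \<Rightarrow> complex) set \<Rightarrow> bool" where
  "algebraic_subvariety I V \<longleftrightarrow>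
     (\<exists>F :: 'v cpoly set. (\<forall>p\<in>F. cpoly_vars p \<subseteq> I) \<and>
        V = {x \<in> affine_space I. \<forall>p\<in>F. cpoly_eval x p = 0})"

definition holds_for_general :: "'v set \<Rightarrow> (('v \<Rightarrow> complex) \<Rightarrow> bool) \<Rightarrow> bool" where
  "holds_for_general I P \<longleftrightarrow>
     (\<exists>V. algebraic_subvariety I V \<and> V \<noteq> affine_space I \<and>
        (\<forall>x \<in> affine_space I - V. P x))"

text \<open>The summation index \<open>k\<close> is the exponent of \<open>u\<^sup>2 + v\<^sup>2\<close>, hence the shift by 2 in the
  coefficients.\<close>

definition solutions ::
    "nat \<Rightarrow> (nat \<Rightarrow> complex) \<Rightarrow> (nat \<Rightarrow> complex) \<Rightarrow> (complex \<times> complex) set" where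
  "solutions n a b = {(u, v).
     a 0 + a 1 * u + a 2 * v + (\<Sum>k=1..n-1. a (k + 2) * u * (u\<^sup>2 + v\<^sup>2) ^ k) = 0 \<and>
     b 0 + b 1 * u + b 2 * v + (\<Sum>k=1..n-1. b (k + 2) * v * (u\<^sup>2 + v\<^sup>2) ^ k) = 0}"

datatype coefficient = Coeff_a nat | Coeff_b nat

definition coefficients :: "nat \<Rightarrow> coefficient set" where
  "coefficients n = Coeff_a ` {0..n+1} \<union> Coeff_b ` {0..n+1}"

datatype parameter = Omega0 | Omega | Lambda | Gamma | Alpha nat

definition parameters :: "nat \<Rightarrow> parameter set" where
  "parameters n = {Omega0, Omega, Lambda, Gamma} \<union> Alpha ` {1..n-1}"

definition harmonic_a :: "(parameter \<Rightarrow> complex) \<Rightarrow> nat \<Rightarrow> complex" where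
  "harmonic_a p j =
     (if j = 0 then 0
      else if j = 1 then ((p Omega0)\<^sup>2 - (p Omega)\<^sup>2) / 2 - p Lambda * (p Omega0)\<^sup>2 / 4
      else if j = 2 then p Gamma * p Omega / 2
      else (let k = j - 2 in p (Alpha k) / 2 ^ (2 * k + 1) * of_nat ((2 * k + 1) choose k)))"

definition harmonic_b :: "(parameter \<Rightarrow> complex) \<Rightarrow> nat \<Rightarrow> complex" where
  "harmonic_b p j =
     (if j = 0 then 0
      else if j = 1 then - (p Gamma * p Omega / 2)
      else if j = 2 then ((p Omega0)\<^sup>2 - (p Omega)\<^sup>2) / 2 + p Lambda * (p Omega0)\<^sup>2 / 4
      else (let k = j - 2 in p (Alpha k) / 2 ^ (2 * k + 1) * of_nat ((2 * k + 1) choose k)))"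

end

theory Submission
  imports
    Defs
    "Subresultants.Subresultant_Gcd"
    "HOL-Computational_Algebra.Fundamental_Theorem_Algebra"
    "HOL-Computational_Algebra.Field_as_Ring"
begin

text \<open>
  Put \<open>r = u\<^sup>2 + v\<^sup>2\<close>. For a fixed value of \<open>r\<close> the system is linear in \<open>(u, v)\<close>, with matrix
  rows \<open>(A(r), a\<^sub>2)\<close> and \<open>(b\<^sub>1, B(r))\<close>, where \<open>A\<close> and \<open>B\<close> are polynomials of degree \<open>n - 1\<close>;
  its determinant \<open>D = A B - a\<^sub>2 b\<^sub>1\<close> has degree \<open>2 n - 2\<close>. So solutions are counted by counting
  the possible values of \<open>r\<close>.

  For general coefficients, Cramer's rule gives \<open>D u = U\<close> and \<open>D v = V\<close> with \<open>U\<close>, \<open>V\<close> of degree at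
  most \<open>n - 1\<close>, and consistency with \<open>r = u\<^sup>2 + v\<^sup>2\<close> becomes the vanishing of the eliminant
  \<open>G = r D\<^sup>2 - U\<^sup>2 - V\<^sup>2\<close>, of degree \<open>4 n - 3\<close>. If \<open>G\<close> has only simple roots and shares none with
  \<open>D\<close>, then \<open>(u, v) \<mapsto> r\<close> is a bijection from the solutions to the roots of \<open>G\<close>
  (\<open>card_solutions_eq_degree_eliminant\<close>).

  For the Harmonic Balance parameters the system is homogeneous, \<open>a\<^sub>0 = b\<^sub>0 = 0\<close>, and the
  eliminant degenerates to \<open>r D\<^sup>2\<close>. The origin is a solution, and every other one lies over a root
  \<open>r\<close> of \<open>D\<close>, where the linear system has a line of solutions. That line contains two
  vectors with \<open>u\<^sup>2 + v\<^sup>2 = r\<close>, unless \<open>r = 0\<close> or the line is isotropic. This gives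
  \<open>1 + 2 (2 n - 2) = 4 n - 3\<close> solutions (\<open>card_solutions_homogeneous\<close>). Isotropy is excluded by
  \<open>\<lambda>\<close>, \<open>\<gamma>\<close>, \<open>\<omega>\<close>, \<open>\<omega>\<^sub>0\<close> being nonzero, because \<open>B - A = \<lambda> \<omega>\<^sub>0\<^sup>2 / 2\<close> is constant.

  In both cases the required conditions say that a polynomial has its full degree, has simple roots
  and avoids the roots of a second polynomial. A resultant turns this into the nonvanishing of a
  polynomial function of the coefficients (\<open>generic_simple_roots_avoiding\<close>), and it only remains
  to exhibit one point at which this function is nonzero.
\<close>

section \<open>Polynomial functions on affine space\<close>

definition monomial_value :: "('v \<Rightarrow> complex) \<Rightarrow> ('v \<Rightarrow>\<^sub>0 nat) \<Rightarrow> complex" where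
  "monomial_value x m = (\<Prod>v\<in>Poly_Mapping.keys m. x v ^ Poly_Mapping.lookup m v)"

lemma monomial_value_superset:
  assumes "finite S" "Poly_Mapping.keys m \<subseteq> S"
  shows "monomial_value x m = (\<Prod>v\<in>S. x v ^ Poly_Mapping.lookup m v)"
  unfolding monomial_value_def
  by (rule prod.mono_neutral_left) (use assms in \<open>auto simp: in_keys_iff\<close>)

lemma monomial_value_add:
  "monomial_value x (m + m') = monomial_value x m * monomial_value x m'"
proof -
  let ?S = "Poly_Mapping.keys m \<union> Poly_Mapping.keys m'"
  have "Poly_Mapping.keys (m + m') \<subseteq> ?S"
    by (rule Poly_Mapping.keys_add)
  then show ?thesis
    by (simp add: monomial_value_superset[of ?S] lookup_add power_add prod.distrib)
qed

lemma cpoly_eval_superset: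
  assumes "finite S" "Poly_Mapping.keys p \<subseteq> S"
  shows "cpoly_eval x p = (\<Sum>m\<in>S. Poly_Mapping.lookup p m * monomial_value x m)"
  unfolding cpoly_eval_def monomial_value_def[symmetric]
  by (rule sum.mono_neutral_left) (use assms in \<open>auto simp: in_keys_iff\<close>)

lemma cpoly_eval_add: "cpoly_eval x (p + q) = cpoly_eval x p + cpoly_eval x q"
proof -
  let ?S = "Poly_Mapping.keys p \<union> Poly_Mapping.keys q"
  have "Poly_Mapping.keys (p + q) \<subseteq> ?S"
    by (rule Poly_Mapping.keys_add)
  then show ?thesis
    by (simp add: cpoly_eval_superset[of ?S] lookup_add algebra_simps sum.distrib)
qed

lemma cpoly_eval_single:
  "cpoly_eval x (Poly_Mapping.single m c) = c * monomial_value x m"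
  by (simp add: cpoly_eval_superset[of "{m}"])

definition regular_function :: "'v set \<Rightarrow> (('v \<Rightarrow> complex) \<Rightarrow> complex) \<Rightarrow> bool" where
  "regular_function I f \<longleftrightarrow> (\<exists>p. cpoly_vars p \<subseteq> I \<and> (\<forall>x. f x = cpoly_eval x p))"

lemma regular_function_monomial:
  assumes "Poly_Mapping.keys m \<subseteq> I"
  shows "regular_function I (\<lambda>x. c * monomial_value x m)"
  unfolding regular_function_def
  by (rule exI[of _ "Poly_Mapping.single m c"])
    (use assms in \<open>auto simp: cpoly_eval_single cpoly_vars_def\<close>)

lemma regular_function_add:
  assumes "regular_function I f" "regular_function I g"
  shows "regular_function I (\<lambda>x. f x + g x)"
proof -
  from assms obtain p q where pq: "cpoly_vars p \<subseteq> I" "cpoly_vars q \<subseteq> I"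
    and eval: "\<And>x. f x = cpoly_eval x p" "\<And>x. g x = cpoly_eval x q"
    unfolding regular_function_def by blast
  have "cpoly_vars (p + q) \<subseteq> I"
    using pq Poly_Mapping.keys_add[of p q] unfolding cpoly_vars_def by blast
  then show ?thesis
    unfolding regular_function_def using eval cpoly_eval_add by metis
qed

lemma regular_function_const: "regular_function I (\<lambda>x. c)"
  using regular_function_monomial[of 0 I c] by (simp add: monomial_value_def)

lemma regular_function_coordinate: "v \<in> I \<Longrightarrow> regular_function I (\<lambda>x. x v)"
  using regular_function_monomial[of "Poly_Mapping.single v 1" I 1]
  by (simp add: monomial_value_def)

lemma regular_function_sum:
  assumes "\<And>i. i \<in> J \<Longrightarrow> regular_function I (f i)"
  shows "regular_function I (\<lambda>x. \<Sum>i\<in>J. f i x)"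
  using assms
  by (induction J rule: infinite_finite_induct)
    (auto intro: regular_function_const regular_function_add)

text \<open>Monomials multiply by adding exponents, so expanding both factors into monomials again gives a
  sum of monomials.\<close>

lemma regular_function_mult:
  assumes "regular_function I f" "regular_function I g"
  shows "regular_function I (\<lambda>x. f x * g x)"
proof -
  from assms obtain p q where pq: "cpoly_vars p \<subseteq> I" "cpoly_vars q \<subseteq> I"
    and eval: "\<And>x. f x = cpoly_eval x p" "\<And>x. g x = cpoly_eval x q"
    unfolding regular_function_def by blast
  let ?P = "Poly_Mapping.keys p" and ?Q = "Poly_Mapping.keys q"
  have "regular_function I
    (\<lambda>x. \<Sum>m\<in>?P. \<Sum>m'\<in>?Q. (Poly_Mapping.lookup p m * Poly_Mapping.lookup q m') * monomial_value x (m + m'))"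
  proof (intro regular_function_sum regular_function_monomial)
    fix m m' assume "m \<in> ?P" "m' \<in> ?Q"
    then show "Poly_Mapping.keys (m + m') \<subseteq> I"
      using pq Poly_Mapping.keys_add[of m m'] unfolding cpoly_vars_def by blast
  qed
  also have "(\<lambda>x. \<Sum>m\<in>?P. \<Sum>m'\<in>?Q. (Poly_Mapping.lookup p m * Poly_Mapping.lookup q m') * monomial_value x (m + m'))
      = (\<lambda>x. f x * g x)"
    by (simp add: eval cpoly_eval_superset[of ?P p] cpoly_eval_superset[of ?Q q] sum_product
        monomial_value_add mult_ac)
  finally show ?thesis .
qed

lemma regular_function_prod:
  assumes "\<And>i. i \<in> J \<Longrightarrow> regular_function I (f i)"
  shows "regular_function I (\<lambda>x. \<Prod>i\<in>J. f i x)"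
  using assms
  by (induction J rule: infinite_finite_induct)
    (auto intro: regular_function_const regular_function_mult)

lemma regular_function_power:
  "regular_function I f \<Longrightarrow> regular_function I (\<lambda>x. f x ^ k)"
  by (induction k) (auto intro: regular_function_const regular_function_mult)

lemma regular_function_uminus:
  "regular_function I f \<Longrightarrow> regular_function I (\<lambda>x. - f x)"
  using regular_function_mult[OF regular_function_const[of I "-1"], of f] by simp

lemma regular_function_diff:
  "regular_function I f \<Longrightarrow> regular_function I g \<Longrightarrow> regular_function I (\<lambda>x. f x - g x)"
  using regular_function_add[OF _ regular_function_uminus, of I f g] by simp

lemma regular_function_divide:
  "regular_function I f \<Longrightarrow> regular_function I (\<lambda>x. f x / c)"
  using regular_function_mult[OF _ regular_function_const[of I "1 / c"], of f] by simp

lemma regular_function_if: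
  "regular_function I f \<Longrightarrow> regular_function I g \<Longrightarrow>
    regular_function I (\<lambda>x. if b then f x else g x)"
  by (cases b) simp_all

lemmas regular_function_intros =
  regular_function_if regular_function_const regular_function_coordinate regular_function_add
  regular_function_mult regular_function_power regular_function_uminus
  regular_function_diff regular_function_divide

text \<open>A polynomial in the coordinates from \<open>I\<close> cannot see the others. Hence a total function may serve
  as a witness of nonvanishing, although points of the affine space are extensional.\<close>

lemma regular_function_restrict:
  assumes "regular_function I f"
  shows "f (restrict x I) = f x"
proof -
  from assms obtain p where vars: "cpoly_vars p \<subseteq> I" and eval: "\<And>x. f x = cpoly_eval x p"
    unfolding regular_function_def by blast
  have "cpoly_eval (restrict x I) p = cpoly_eval x p"
    unfolding cpoly_eval_def
  proof (intro sum.cong refl arg_cong2[of _ _ _ _ "(*)"] prod.cong)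
    fix m v assume "m \<in> Poly_Mapping.keys p" "v \<in> Poly_Mapping.keys m"
    then show "restrict x I v ^ Poly_Mapping.lookup m v = x v ^ Poly_Mapping.lookup m v"
      using vars by (auto simp: cpoly_vars_def)
  qed
  then show ?thesis by (simp add: eval)
qed

text \<open>The hypersurface \<open>f = 0\<close> serves as the exceptional subvariety; it is proper because of the
  witness \<open>y\<close>.\<close>

lemma holds_for_general_if_nonvanishing:
  assumes reg: "regular_function I f" and nz: "f y \<noteq> 0" and P: "\<And>x. f x \<noteq> 0 \<Longrightarrow> P x"
  shows "holds_for_general I P"
proof -
  from reg obtain p where vars: "cpoly_vars p \<subseteq> I" and eval: "\<And>x. f x = cpoly_eval x p"
    unfolding regular_function_def by blast
  let ?V = "{x \<in> affine_space I. \<forall>q\<in>{p}. cpoly_eval x q = 0}"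
  have "algebraic_subvariety I ?V"
    unfolding algebraic_subvariety_def using vars by blast
  moreover have "restrict y I \<in> affine_space I - ?V"
    using nz regular_function_restrict[OF reg, of y] by (auto simp: affine_space_def eval)
  moreover have "\<forall>x\<in>affine_space I - ?V. P x"
    using P by (auto simp: eval)
  ultimately show ?thesis
    unfolding holds_for_general_def by blast
qed

section \<open>Generic simplicity of roots\<close>

definition regular_family :: "'v set \<Rightarrow> (('v \<Rightarrow> complex) \<Rightarrow> complex poly) \<Rightarrow> bool" where
  "regular_family I p \<longleftrightarrow> (\<forall>k. regular_function I (\<lambda>x. coeff (p x) k))"

lemma regular_family_const_poly: "regular_family I (\<lambda>x. p)"
  by (simp add: regular_family_def regular_function_const)

lemma regular_family_monom:
  "regular_function I f \<Longrightarrow> regular_family I (\<lambda>x. monom (f x) k)"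
  by (simp add: regular_family_def coeff_monom regular_function_intros)

lemma regular_family_add:
  "regular_family I p \<Longrightarrow> regular_family I q \<Longrightarrow> regular_family I (\<lambda>x. p x + q x)"
  by (auto simp: regular_family_def intro: regular_function_intros)

lemma regular_family_diff:
  "regular_family I p \<Longrightarrow> regular_family I q \<Longrightarrow> regular_family I (\<lambda>x. p x - q x)"
  by (auto simp: regular_family_def intro: regular_function_intros)

lemma regular_family_mult:
  "regular_family I p \<Longrightarrow> regular_family I q \<Longrightarrow> regular_family I (\<lambda>x. p x * q x)"
  by (auto simp: regular_family_def coeff_mult intro!: regular_function_sum regular_function_mult)

lemma regular_family_power:
  "regular_family I p \<Longrightarrow> regular_family I (\<lambda>x. p x ^ k)"
  by (induction k) (auto intro: regular_family_mult regular_family_const_poly)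

lemma regular_family_sum:
  assumes "\<And>i. i \<in> J \<Longrightarrow> regular_family I (p i)"
  shows "regular_family I (\<lambda>x. \<Sum>i\<in>J. p i x)"
  using assms by (auto simp: regular_family_def coeff_sum intro!: regular_function_sum)

lemma regular_family_pderiv:
  "regular_family I p \<Longrightarrow> regular_family I (\<lambda>x. pderiv (p x))"
  by (auto simp: regular_family_def coeff_pderiv intro!: regular_function_intros)

lemmas regular_family_intros =
  regular_family_const_poly regular_family_monom regular_family_add regular_family_diff
  regular_family_mult regular_family_power regular_family_sum regular_family_pderiv

text \<open>The formal degrees \<open>d\<close> and \<open>e\<close> fix the shape of the Sylvester matrix. With the actual degrees,
  which may jump with \<open>x\<close>, the resultant would not be a single polynomial in the coefficients.\<close>

lemma regular_function_resultant_sub: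
  assumes "regular_family I p" "regular_family I q"
  shows "regular_function I (\<lambda>x. resultant_sub d e (p x) (q x))"
proof -
  let ?M = "\<lambda>x. sylvester_mat_sub d e (p x) (q x)"
  have det: "resultant_sub d e (p x) (q x) =
      (\<Sum>\<pi> | \<pi> permutes {0..<d+e}. signof \<pi> * (\<Prod>i = 0..<d+e. ?M x $$ (i, \<pi> i)))" for x
    unfolding resultant_sub_def by (rule det_def') (rule sylvester_mat_sub_carrier)
  have entry: "regular_function I (\<lambda>x. ?M x $$ (i, \<pi> i))"
    if "\<pi> permutes {0..<d+e}" "i \<in> {0..<d+e}" for \<pi> i
  proof -
    have "i < d + e" "\<pi> i < d + e"
      using that permutes_in_image[OF that(1), of i] by auto
    then show ?thesis
      using assms by (simp add: sylvester_mat_sub_index regular_family_def regular_function_intros)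
  qed
  show ?thesis
    unfolding det by (intro regular_function_sum regular_function_mult regular_function_const
        regular_function_prod) (auto intro: entry)
qed

text \<open>Over an algebraically closed field a nonconstant gcd has a root.\<close>

lemma resultant_eq_0_iff_common_root:
  fixes p q :: "complex poly"
  assumes "p \<noteq> 0"
  shows "resultant p q = 0 \<longleftrightarrow> (\<exists>z. poly p z = 0 \<and> poly q z = 0)"
proof -
  have "degree (gcd p q) \<noteq> 0 \<longleftrightarrow> (\<exists>z. poly (gcd p q) z = 0)"
  proof
    assume "degree (gcd p q) \<noteq> 0"
    then show "\<exists>z. poly (gcd p q) z = 0"
      using fundamental_theorem_of_algebra[of "gcd p q"] by (simp add: constant_degree)
  next
    assume "\<exists>z. poly (gcd p q) z = 0"
    then show "degree (gcd p q) \<noteq> 0"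
      using assms by (metis degree_eq_zeroE gcd_eq_0_iff mult_zero_right pCons_0_0 poly_const_conv)
  qed
  also have "\<dots> \<longleftrightarrow> (\<exists>z. poly p z = 0 \<and> poly q z = 0)"
    by (simp add: poly_eq_0_iff_dvd)
  finally show ?thesis
    by (simp add: resultant_0_gcd)
qed

text \<open>The function \<open>f\<close> is the resultant of \<open>p\<close> and \<open>h p'\<close> in their maximal degrees, multiplied by the
  leading coefficients of \<open>p\<close> and \<open>h\<close>. These factors force the actual degrees to be the formal
  ones, so that the formal resultant is the true one and detects common roots.\<close>

lemma generic_simple_roots_avoiding:
  assumes p: "regular_family I p" and h: "regular_family I h"
    and deg_p: "\<And>x. degree (p x) \<le> d" and deg_h: "\<And>x. degree (h x) \<le> e" and d: "d \<ge> 1"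
  obtains f where "regular_function I f"
    and "\<And>x. f x \<noteq> 0 \<longleftrightarrow> degree (p x) = d \<and> degree (h x) = e \<and>
           (\<forall>z. poly (p x) z = 0 \<longrightarrow> poly (h x) z \<noteq> 0 \<and> poly (pderiv (p x)) z \<noteq> 0)"
proof
  let ?f = "\<lambda>x. (coeff (p x) d * coeff (h x) e) *
    resultant_sub d (e + (d - 1)) (p x) (h x * pderiv (p x))"
  show "regular_function I ?f"
    using p h by (intro regular_function_mult regular_function_resultant_sub regular_family_mult
        regular_family_pderiv) (auto simp: regular_family_def)
  show "?f x \<noteq> 0 \<longleftrightarrow> degree (p x) = d \<and> degree (h x) = e \<and>
           (\<forall>z. poly (p x) z = 0 \<longrightarrow> poly (h x) z \<noteq> 0 \<and> poly (pderiv (p x)) z \<noteq> 0)" for x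
  proof (cases "degree (p x) = d \<and> coeff (h x) e \<noteq> 0")
    case True
    then have deg: "degree (p x) = d" "degree (h x) = e" "h x \<noteq> 0" "p x \<noteq> 0"
      using deg_h[of x] le_degree[of "h x" e] d by auto
    have "degree (h x * pderiv (p x)) = e + (d - 1)"
      using deg d by (simp add: degree_mult_eq degree_pderiv pderiv_eq_0_iff)
    then have "resultant_sub d (e + (d - 1)) (p x) (h x * pderiv (p x))
        = resultant (p x) (h x * pderiv (p x))"
      by (simp add: resultant_sub deg)
    moreover have "coeff (p x) d \<noteq> 0"
      using deg by auto
    ultimately show ?thesis
      using True deg resultant_eq_0_iff_common_root[OF deg(4), of "h x * pderiv (p x)"] by auto
  next
    case False
    have "coeff (p x) d = 0" if "degree (p x) \<noteq> d"
      using that deg_p[of x] by (simp add: coeff_eq_0)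
    moreover have "\<not> (degree (h x) = e \<and>
           (\<forall>z. poly (p x) z = 0 \<longrightarrow> poly (h x) z \<noteq> 0))"
      if c: "coeff (h x) e = 0" and dp: "degree (p x) = d"
    proof
      assume *: "degree (h x) = e \<and> (\<forall>z. poly (p x) z = 0 \<longrightarrow> poly (h x) z \<noteq> 0)"
      then have "h x = 0" using c by auto
      moreover obtain z where "poly (p x) z = 0"
        using fundamental_theorem_of_algebra[of "p x"] dp d by (auto simp: constant_degree)
      ultimately show False using * by auto
    qed
    ultimately show ?thesis using False by auto
  qed
qed

lemma card_roots_eq_degree:
  fixes p :: "complex poly"
  assumes "p \<noteq> 0" "\<And>z. poly p z = 0 \<Longrightarrow> poly (pderiv p) z \<noteq> 0"
  shows "card {z. poly p z = 0} = degree p"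
proof -
  have "rsquarefree p" using assms(2) by (auto simp: rsquarefree_roots)
  then have p: "p = smult (lead_coeff p) (\<Prod>z | poly p z = 0. [:-z, 1:])"
    by (rule complex_poly_decompose_rsquarefree[symmetric])
  have "degree p = degree (\<Prod>z | poly p z = 0. [:-z, 1:])"
    using assms(1) by (subst p) (simp del: prod.cong)
  also have "\<dots> = card {z. poly p z = 0}"
    by (subst degree_prod_eq_sum_degree) auto
  finally show ?thesis by simp
qed

section \<open>Elimination for a fixed amplitude\<close>

text \<open>The diagonal entries of the linear system: \<open>l = 1\<close> gives \<open>A\<close> from the coefficients \<open>a\<close>, and
  \<open>l = 2\<close> gives \<open>B\<close> from the coefficients \<open>b\<close>.\<close>

definition amplitude_poly :: "nat \<Rightarrow> nat \<Rightarrow> (nat \<Rightarrow> complex) \<Rightarrow> complex poly" where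
  "amplitude_poly n l a = monom (a l) 0 + (\<Sum>k=1..n-1. monom (a (k + 2)) k)"

lemma poly_amplitude_poly:
  "poly (amplitude_poly n l a) r = a l + (\<Sum>k=1..n-1. a (k + 2) * r ^ k)"
  by (simp add: amplitude_poly_def poly_sum poly_monom)

lemma solutions_iff_linear:
  "(u, v) \<in> solutions n a b \<longleftrightarrow>
     a 0 + poly (amplitude_poly n 1 a) (u\<^sup>2 + v\<^sup>2) * u + a 2 * v = 0 \<and>
     b 0 + b 1 * u + poly (amplitude_poly n 2 b) (u\<^sup>2 + v\<^sup>2) * v = 0"
proof -
  have split: "(\<Sum>k=1..n-1. c (k + 2) * w * r ^ k) = (\<Sum>k=1..n-1. c (k + 2) * r ^ k) * w"
    for c :: "nat \<Rightarrow> complex" and w r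
    unfolding sum_distrib_right by (intro sum.cong) (simp_all add: mult_ac)
  then show ?thesis
    unfolding solutions_def poly_amplitude_poly split
    by (simp only: mem_Collect_eq case_prod_conv distrib_right add_ac)
qed

lemma degree_amplitude_poly: "degree (amplitude_poly n l a) \<le> n - 1"
  unfolding amplitude_poly_def
  by (intro degree_add_le degree_sum_le) (auto intro: order.trans[OF degree_monom_le])

definition determinant_poly :: "nat \<Rightarrow> (nat \<Rightarrow> complex) \<Rightarrow> (nat \<Rightarrow> complex) \<Rightarrow> complex poly" where
  "determinant_poly n a b =
     amplitude_poly n 1 a * amplitude_poly n 2 b - monom (a 2 * b 1) 0"

definition u_numerator :: "nat \<Rightarrow> (nat \<Rightarrow> complex) \<Rightarrow> (nat \<Rightarrow> complex) \<Rightarrow> complex poly" where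
  "u_numerator n a b = monom (a 2 * b 0) 0 - monom (a 0) 0 * amplitude_poly n 2 b"

definition v_numerator :: "nat \<Rightarrow> (nat \<Rightarrow> complex) \<Rightarrow> (nat \<Rightarrow> complex) \<Rightarrow> complex poly" where
  "v_numerator n a b = monom (a 0 * b 1) 0 - monom (b 0) 0 * amplitude_poly n 1 a"

text \<open>Up to the factor \<open>D\<^sup>2\<close>, this is \<open>r - u\<^sup>2 - v\<^sup>2\<close> with \<open>u = U / D\<close> and \<open>v = V / D\<close>.\<close>

definition eliminant_poly :: "nat \<Rightarrow> (nat \<Rightarrow> complex) \<Rightarrow> (nat \<Rightarrow> complex) \<Rightarrow> complex poly" where
  "eliminant_poly n a b =
     monom 1 1 * (determinant_poly n a b)\<^sup>2 - (u_numerator n a b)\<^sup>2 - (v_numerator n a b)\<^sup>2"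

lemma degree_determinant_poly: "degree (determinant_poly n a b) \<le> 2 * (n - 1)"
proof -
  have "degree (amplitude_poly n 1 a * amplitude_poly n 2 b) \<le> 2 * (n - 1)"
    using degree_amplitude_poly[of n 1 a] degree_amplitude_poly[of n 2 b]
    by (intro order.trans[OF degree_mult_le]) simp
  then show ?thesis
    unfolding determinant_poly_def by (intro degree_diff_le) (auto simp: monom_0)
qed

lemma degree_u_numerator: "degree (u_numerator n a b) \<le> n - 1"
  unfolding u_numerator_def
  by (intro degree_diff_le order.trans[OF degree_mult_le])
    (use degree_amplitude_poly[of n 1 a] degree_amplitude_poly[of n 2 b] in \<open>auto simp: monom_0\<close>)

lemma degree_v_numerator: "degree (v_numerator n a b) \<le> n - 1"
  unfolding v_numerator_def
  by (intro degree_diff_le order.trans[OF degree_mult_le])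
    (use degree_amplitude_poly[of n 1 a] degree_amplitude_poly[of n 2 b] in \<open>auto simp: monom_0\<close>)

lemma degree_eliminant_poly:
  assumes "n \<ge> 1"
  shows "degree (eliminant_poly n a b) \<le> 4 * n - 3"
proof -
  have "degree (monom 1 1 * (determinant_poly n a b)\<^sup>2) \<le> 4 * n - 3"
    using degree_determinant_poly[of n a b] degree_power_le[of "determinant_poly n a b" 2]
      degree_monom_le[of "1::complex" 1] assms
    by (intro order.trans[OF degree_mult_le]) simp
  moreover have "degree ((u_numerator n a b)\<^sup>2) \<le> 4 * n - 3"
    using degree_u_numerator[of n a b] degree_power_le[of "u_numerator n a b" 2] assms by simp
  moreover have "degree ((v_numerator n a b)\<^sup>2) \<le> 4 * n - 3"
    using degree_v_numerator[of n a b] degree_power_le[of "v_numerator n a b" 2] assms by simp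
  ultimately show ?thesis
    unfolding eliminant_poly_def by (intro degree_diff_le)
qed

text \<open>The equations multiplied by the adjugate matrix. These identities also hold where the determinant
  vanishes, so they apply to a solution before its determinant is known to be nonzero.\<close>

lemma cramer_identities:
  fixes A B a0 a2 b0 b1 u v :: "'a :: comm_ring_1"
  shows "(A * B - a2 * b1) * u =
      (a2 * b0 - a0 * B) + B * (a0 + A * u + a2 * v) - a2 * (b0 + b1 * u + B * v)"
    and "(A * B - a2 * b1) * v =
      (a0 * b1 - b0 * A) + A * (b0 + b1 * u + B * v) - b1 * (a0 + A * u + a2 * v)"
  by (simp_all add: algebra_simps)

lemma cramer_2x2:
  fixes A B a0 a2 b0 b1 u v :: "'a :: field"
  assumes "A * B - a2 * b1 \<noteq> 0"
  shows "a0 + A * u + a2 * v = 0 \<and> b0 + b1 * u + B * v = 0 \<longleftrightarrow>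
    u = (a2 * b0 - a0 * B) / (A * B - a2 * b1) \<and> v = (a0 * b1 - b0 * A) / (A * B - a2 * b1)"
    (is "?L \<longleftrightarrow> ?R")
proof
  assume ?L
  then show ?R
    using assms cramer_identities[where A = A and B = B and ?a0.0 = a0 and ?a2.0 = a2 and ?b0.0 = b0 and ?b1.0 = b1
        and u = u and v = v]
    by (simp add: nonzero_eq_divide_eq mult.commute[of _ "A * B - a2 * b1"])
next
  let ?d = "A * B - a2 * b1"
  assume ?R
  then have du: "?d * u = a2 * b0 - a0 * B" and dv: "?d * v = a0 * b1 - b0 * A"
    using assms by simp_all
  have "?d * (a0 + A * u + a2 * v) = ?d * a0 + A * (?d * u) + a2 * (?d * v)"
    "?d * (b0 + b1 * u + B * v) = ?d * b0 + b1 * (?d * u) + B * (?d * v)"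
    by (simp_all only: distrib_left mult.left_commute)
  then have "?d * (a0 + A * u + a2 * v) = 0" "?d * (b0 + b1 * u + B * v) = 0"
    unfolding du dv by (simp_all add: algebra_simps)
  then show ?L using assms by simp
qed

text \<open>A solution makes the eliminant vanish at \<open>r = u\<^sup>2 + v\<^sup>2\<close>, so \<open>D(r) \<noteq> 0\<close> by hypothesis, and
  Cramer's rule recovers \<open>(u, v)\<close> from \<open>r\<close>. Conversely, at a root of the eliminant the vector
  \<open>(U / D, V / D)\<close> has the right value of \<open>u\<^sup>2 + v\<^sup>2\<close> and hence solves the nonlinear system.\<close>

lemma card_solutions_eq_degree_eliminant:
  assumes G: "eliminant_poly n a b \<noteq> 0"
    and simple: "\<And>r. poly (eliminant_poly n a b) r = 0 \<Longrightarrow>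
      poly (determinant_poly n a b) r \<noteq> 0 \<and> poly (pderiv (eliminant_poly n a b)) r \<noteq> 0"
  shows "card (solutions n a b) = degree (eliminant_poly n a b)"
proof -
  let ?A = "poly (amplitude_poly n 1 a)" and ?B = "poly (amplitude_poly n 2 b)"
  let ?D = "poly (determinant_poly n a b)" and ?G = "poly (eliminant_poly n a b)"
  let ?U = "poly (u_numerator n a b)" and ?V = "poly (v_numerator n a b)"
  have D: "?D r = ?A r * ?B r - a 2 * b 1" for r
    by (simp add: determinant_poly_def poly_monom)
  have U: "?U r = a 2 * b 0 - a 0 * ?B r" and V: "?V r = a 0 * b 1 - b 0 * ?A r" for r
    by (simp_all add: u_numerator_def v_numerator_def poly_monom)
  have G_eq: "?G r = r * (?D r)\<^sup>2 - (?U r)\<^sup>2 - (?V r)\<^sup>2" for r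
    by (simp add: eliminant_poly_def poly_monom)
  have sol_root: "?G (u\<^sup>2 + v\<^sup>2) = 0" if "(u, v) \<in> solutions n a b" for u v
  proof -
    let ?r = "u\<^sup>2 + v\<^sup>2"
    from that have "?D ?r * u = ?U ?r" "?D ?r * v = ?V ?r"
      using cramer_identities[where A = "?A ?r" and B = "?B ?r" and ?a0.0 = "a 0"
          and ?a2.0 = "a 2" and ?b0.0 = "b 0" and ?b1.0 = "b 1" and u = u and v = v]
      unfolding solutions_iff_linear D U V by simp_all
    then have "?G ?r = ?r * (?D ?r)\<^sup>2 - (?D ?r * u)\<^sup>2 - (?D ?r * v)\<^sup>2"
      by (simp add: G_eq)
    then show ?thesis by (simp add: power_mult_distrib algebra_simps)
  qed
  have root_norm: "(?U r / ?D r)\<^sup>2 + (?V r / ?D r)\<^sup>2 = r" if "?G r = 0" for r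
  proof -
    have "?D r \<noteq> 0" using simple that by blast
    moreover have "(?U r)\<^sup>2 + (?V r)\<^sup>2 = r * (?D r)\<^sup>2"
      using that by (simp add: G_eq algebra_simps)
    ultimately show ?thesis
      by (simp add: power_divide flip: add_divide_distrib)
  qed
  have "bij_betw (\<lambda>(u, v). u\<^sup>2 + v\<^sup>2) (solutions n a b) {r. ?G r = 0}"
  proof (rule bij_betw_byWitness[where f' = "\<lambda>r. (?U r / ?D r, ?V r / ?D r)"])
    show "\<forall>s\<in>solutions n a b. (\<lambda>r. (?U r / ?D r, ?V r / ?D r)) (case s of (u, v) \<Rightarrow> u\<^sup>2 + v\<^sup>2) = s"
    proof
      fix s assume "s \<in> solutions n a b"
      then obtain u v where uv: "s = (u, v)" and s: "(u, v) \<in> solutions n a b"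
        by (cases s) auto
      have "?D (u\<^sup>2 + v\<^sup>2) \<noteq> 0" using simple sol_root[OF s] by blast
      from cramer_2x2[OF this[unfolded D], of "a 0" u v "b 0"] s
      show "(\<lambda>r. (?U r / ?D r, ?V r / ?D r)) (case s of (u, v) \<Rightarrow> u\<^sup>2 + v\<^sup>2) = s"
        unfolding uv solutions_iff_linear D U V by simp
    qed
    show "\<forall>r\<in>{r. ?G r = 0}. (case (?U r / ?D r, ?V r / ?D r) of (u, v) \<Rightarrow> u\<^sup>2 + v\<^sup>2) = r"
      using root_norm by simp
    show "(\<lambda>(u, v). u\<^sup>2 + v\<^sup>2) ` solutions n a b \<subseteq> {r. ?G r = 0}"
      using sol_root by auto
    show "(\<lambda>r. (?U r / ?D r, ?V r / ?D r)) ` {r. ?G r = 0} \<subseteq> solutions n a b"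
    proof safe
      fix r assume r: "?G r = 0"
      then have "?D r \<noteq> 0" using simple by blast
      from cramer_2x2[OF this[unfolded D], of "a 0" "?U r / ?D r" "?V r / ?D r" "b 0"]
      show "(?U r / ?D r, ?V r / ?D r) \<in> solutions n a b"
        unfolding solutions_iff_linear root_norm[OF r] by (simp add: D U V)
    qed
  qed
  then have "card (solutions n a b) = card {r. ?G r = 0}"
    by (rule bij_betw_same_card)
  also have "\<dots> = degree (eliminant_poly n a b)"
    using simple by (intro card_roots_eq_degree[OF G]) blast
  finally show ?thesis .
qed

text \<open>The vector \<open>(u, - A u / c)\<close> runs through the kernel of the row \<open>(A, c)\<close>.\<close>

lemma norm_on_line_eq_iff:
  fixes A c r u :: "'a :: field"
  assumes "c \<noteq> 0" "c\<^sup>2 + A\<^sup>2 \<noteq> 0"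
  shows "u\<^sup>2 + (- A * u / c)\<^sup>2 = r \<longleftrightarrow> u\<^sup>2 = r * c\<^sup>2 / (c\<^sup>2 + A\<^sup>2)"
proof -
  have norm: "u\<^sup>2 + (- A * u / c)\<^sup>2 = u\<^sup>2 * (c\<^sup>2 + A\<^sup>2) / c\<^sup>2"
    using assms(1) by (simp add: power_divide power_mult_distrib distrib_left add_divide_distrib mult.commute)
  show ?thesis
    unfolding norm using assms by (simp add: nonzero_divide_eq_eq nonzero_eq_divide_eq)
qed

text \<open>A nonzero solution is a kernel vector of the matrix at \<open>r = u\<^sup>2 + v\<^sup>2\<close>, so \<open>D(r) = 0\<close>, and the
  first equation gives \<open>v = - A(r) u / a\<^sub>2\<close>. It is therefore determined by \<open>r\<close> and \<open>u\<close>, where \<open>u\<close> is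
  one of the two square roots of a nonzero number depending on \<open>r\<close>.\<close>

lemma card_solutions_homogeneous:
  assumes hom: "a 0 = 0" "b 0 = 0" and a2: "a 2 \<noteq> 0"
    and D0: "determinant_poly n a b \<noteq> 0"
    and simple: "\<And>r. poly (determinant_poly n a b) r = 0 \<Longrightarrow>
      r \<noteq> 0 \<and> poly (pderiv (determinant_poly n a b)) r \<noteq> 0"
    and aniso: "\<And>r. poly (determinant_poly n a b) r = 0 \<Longrightarrow>
      (a 2)\<^sup>2 + (poly (amplitude_poly n 1 a) r)\<^sup>2 \<noteq> 0"
  shows "card (solutions n a b) = 2 * degree (determinant_poly n a b) + 1"
proof -
  let ?A = "poly (amplitude_poly n 1 a)" and ?B = "poly (amplitude_poly n 2 b)"
  let ?D = "poly (determinant_poly n a b)"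
  let ?w = "\<lambda>r. r * (a 2)\<^sup>2 / ((a 2)\<^sup>2 + (?A r)\<^sup>2)"
  let ?S = "SIGMA r:{r. ?D r = 0}. {u. u\<^sup>2 = ?w r}"
  have D: "?D r = ?A r * ?B r - a 2 * b 1" for r
    by (simp add: determinant_poly_def poly_monom)
  have sol: "(u, v) \<in> solutions n a b \<longleftrightarrow>
     ?A (u\<^sup>2 + v\<^sup>2) * u + a 2 * v = 0 \<and> b 1 * u + ?B (u\<^sup>2 + v\<^sup>2) * v = 0" for u v
    by (simp add: solutions_iff_linear hom)
  have D_root: "?D (u\<^sup>2 + v\<^sup>2) = 0" if s: "(u, v) \<in> solutions n a b" and nz: "(u, v) \<noteq> (0, 0)" for u v
  proof -
    from s have "?D (u\<^sup>2 + v\<^sup>2) * u = 0" "?D (u\<^sup>2 + v\<^sup>2) * v = 0"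
      using cramer_identities[where A = "?A (u\<^sup>2 + v\<^sup>2)" and B = "?B (u\<^sup>2 + v\<^sup>2)" and ?a0.0 = 0
          and ?a2.0 = "a 2" and ?b0.0 = 0 and ?b1.0 = "b 1" and u = u and v = v]
      unfolding sol D by simp_all
    then show ?thesis using nz by auto
  qed
  have v_eq: "v = - ?A (u\<^sup>2 + v\<^sup>2) * u / a 2" if s: "(u, v) \<in> solutions n a b" for u v
  proof -
    from s have "a 2 * v = - (?A (u\<^sup>2 + v\<^sup>2) * u)"
      unfolding sol by (simp add: eq_neg_iff_add_eq_0 add.commute)
    then show ?thesis using a2 by (simp add: field_simps)
  qed
  have norm_eq: "u\<^sup>2 + (- ?A r * u / a 2)\<^sup>2 = r \<longleftrightarrow> u\<^sup>2 = ?w r" if "?D r = 0" for u r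
    using a2 aniso[OF that] by (rule norm_on_line_eq_iff)
  have bij: "bij_betw (\<lambda>(u, v). (u\<^sup>2 + v\<^sup>2, u)) (solutions n a b - {(0, 0)}) ?S"
  proof (rule bij_betw_byWitness[where f' = "\<lambda>(r, u). (u, - ?A r * u / a 2)"])
    show "\<forall>s\<in>solutions n a b - {(0, 0)}.
        (\<lambda>(r, u). (u, - ?A r * u / a 2)) (case s of (u, v) \<Rightarrow> (u\<^sup>2 + v\<^sup>2, u)) = s"
      using v_eq by auto
    show "\<forall>s\<in>?S. (\<lambda>(u, v). (u\<^sup>2 + v\<^sup>2, u)) (case s of (r, u) \<Rightarrow> (u, - ?A r * u / a 2)) = s"
    proof
      fix s assume "s \<in> ?S"
      then obtain r u where s: "s = (r, u)" and r: "?D r = 0" and u: "u\<^sup>2 = ?w r"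
        by blast
      have norm: "u\<^sup>2 + (- ?A r * u / a 2)\<^sup>2 = r"
        using norm_eq[OF r] u by blast
      show "(\<lambda>(u, v). (u\<^sup>2 + v\<^sup>2, u)) (case s of (r, u) \<Rightarrow> (u, - ?A r * u / a 2)) = s"
        by (simp only: s prod.case norm)
    qed
    show "(\<lambda>(u, v). (u\<^sup>2 + v\<^sup>2, u)) ` (solutions n a b - {(0, 0)}) \<subseteq> ?S"
    proof (rule image_subsetI)
      fix s assume "s \<in> solutions n a b - {(0, 0)}"
      then obtain u v where uv: "s = (u, v)" and s: "(u, v) \<in> solutions n a b"
        and nz: "(u, v) \<noteq> (0, 0)"
        by (cases s) auto
      have root: "?D (u\<^sup>2 + v\<^sup>2) = 0" using D_root[OF s nz] .
      have "u\<^sup>2 = ?w (u\<^sup>2 + v\<^sup>2)"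
        using norm_eq[OF root, of u] v_eq[OF s] by metis
      with root show "(\<lambda>(u, v). (u\<^sup>2 + v\<^sup>2, u)) s \<in> ?S"
        unfolding uv prod.case by blast
    qed
    show "(\<lambda>(r, u). (u, - ?A r * u / a 2)) ` ?S \<subseteq> solutions n a b - {(0, 0)}"
    proof (rule image_subsetI)
      fix s assume "s \<in> ?S"
      then obtain r u where s: "s = (r, u)" and r: "?D r = 0" and u: "u\<^sup>2 = ?w r"
        by blast
      have norm: "u\<^sup>2 + (- ?A r * u / a 2)\<^sup>2 = r"
        using norm_eq[OF r] u by blast
      have AB: "?A r * ?B r = a 2 * b 1" using r by (simp add: D)
      have "?B r * (- ?A r * u / a 2) = - (?A r * ?B r) * u / a 2"
        by (simp add: mult_ac)
      then have "(u, - ?A r * u / a 2) \<in> solutions n a b"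
        unfolding sol norm AB using a2 by simp
      moreover have "(u, - ?A r * u / a 2) \<noteq> (0, 0)"
        using norm simple[OF r] by auto
      ultimately show "(\<lambda>(r, u). (u, - ?A r * u / a 2)) s \<in> solutions n a b - {(0, 0)}"
        unfolding s prod.case by blast
    qed
  qed
  then have "card (solutions n a b - {(0, 0)}) = card ?S"
    by (rule bij_betw_same_card)
  also have "\<dots> = (\<Sum>r | ?D r = 0. card {u. u\<^sup>2 = ?w r})"
  proof (rule card_SigmaI)
    show "finite {r. ?D r = 0}" by (rule poly_roots_finite[OF D0])
    show "\<forall>r\<in>{r. ?D r = 0}. finite {u. u\<^sup>2 = ?w r}"
      by (intro ballI finite_nth_roots) simp
  qed
  also have "\<dots> = (\<Sum>r | ?D r = 0. 2)"
    using simple aniso a2 by (intro sum.cong refl card_nth_roots) auto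
  also have "\<dots> = 2 * degree (determinant_poly n a b)"
    using card_roots_eq_degree[OF D0] simple by simp
  finally have card: "card (solutions n a b - {(0, 0)}) = 2 * degree (determinant_poly n a b)" .
  have "finite ?S"
    by (intro finite_SigmaI poly_roots_finite[OF D0] finite_nth_roots) simp
  then have "finite (solutions n a b - {(0, 0)})"
    using bij by (simp only: bij_betw_finite)
  then have "finite (solutions n a b)"
    by (simp only: finite_Diff2 finite.intros)
  moreover have "(0, 0) \<in> solutions n a b" by (simp add: sol)
  ultimately have "card (solutions n a b) = Suc (card (solutions n a b - {(0, 0)}))"
    by (rule card.remove)
  then show ?thesis
    unfolding card by simp
qed

lemma regular_family_amplitude_poly:
  assumes "\<And>j. j \<le> n + 1 \<Longrightarrow> regular_function I (\<lambda>x. a x j)" "l \<le> n + 1"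
  shows "regular_family I (\<lambda>x. amplitude_poly n l (a x))"
  unfolding amplitude_poly_def by (intro regular_family_intros assms) (use assms(2) in auto)

context
  fixes I :: "'v set" and a b :: "('v \<Rightarrow> complex) \<Rightarrow> nat \<Rightarrow> complex" and n :: nat
  assumes n: "n \<ge> 1"
    and reg: "\<And>j. j \<le> n + 1 \<Longrightarrow> regular_function I (\<lambda>x. a x j)"
      "\<And>j. j \<le> n + 1 \<Longrightarrow> regular_function I (\<lambda>x. b x j)"
begin

lemma regular_family_determinant_poly: "regular_family I (\<lambda>x. determinant_poly n (a x) (b x))"
  unfolding determinant_poly_def
  by (intro regular_family_intros regular_family_amplitude_poly regular_function_intros reg)
    (use n in auto)

lemma regular_family_eliminant_poly: "regular_family I (\<lambda>x. eliminant_poly n (a x) (b x))"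
  unfolding eliminant_poly_def u_numerator_def v_numerator_def
  by (intro regular_family_intros regular_family_determinant_poly regular_family_amplitude_poly
      regular_function_intros reg) (use n in auto)

end

section \<open>General coefficients\<close>

text \<open>Keeping only \<open>a\<^sub>0\<close>, \<open>b\<^sub>1\<close> and the top coefficients gives, with \<open>m = n - 1\<close>, \<open>A = B = r\<^sup>m\<close>,
  \<open>D = r\<^bsup>2m\<^esup>\<close> and \<open>G = r\<^bsup>4m+1\<^esup> - r\<^bsup>2m\<^esup> - 1\<close>. The only root of \<open>D\<close> is \<open>0\<close>, which is no root of \<open>G\<close>.
  A double root \<open>z\<close> of \<open>G\<close> would satisfy \<open>\<bar>z\<^bsup>2m\<^esup>\<bar> = (4m+1)/(2m+1) > 1\<close> and
  \<open>\<bar>z\<^bsup>4m+1\<^esup>\<bar> = 2m/(2m+1) < 1\<close>, which is impossible.\<close>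

lemma eliminant_witness:
  fixes n :: nat
  assumes n: "n \<ge> 2"
  defines "a \<equiv> \<lambda>j. if j = 0 \<or> j = n + 1 then 1 else 0 :: complex"
    and "b \<equiv> \<lambda>j. if j = 1 \<or> j = n + 1 then 1 else 0 :: complex"
  shows "degree (eliminant_poly n a b) = 4 * n - 3"
    and "degree (determinant_poly n a b) = 2 * (n - 1)"
    and "poly (eliminant_poly n a b) z = 0 \<Longrightarrow>
      poly (determinant_poly n a b) z \<noteq> 0 \<and> poly (pderiv (eliminant_poly n a b)) z \<noteq> 0"
proof -
  define m where "m = n - 1"
  have m: "m \<ge> 1" "n = m + 1" using n by (auto simp: m_def)
  have sum: "(\<Sum>k=1..n-1. monom (c (k + 2)) k) = monom 1 m"
    if "\<And>j. j \<ge> 2 \<Longrightarrow> c j = (if j = n + 1 then 1 else 0)" for c :: "nat \<Rightarrow> complex"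
  proof -
    have "(\<Sum>k=1..n-1. monom (c (k + 2)) k) = (\<Sum>k=1..n-1. if k = m then monom 1 k else 0)"
      using m that by (intro sum.cong) auto
    then show ?thesis using m by simp
  qed
  have A: "amplitude_poly n 1 a = monom 1 m" and B: "amplitude_poly n 2 b = monom 1 m"
    unfolding amplitude_poly_def using n sum[of a] sum[of b] by (auto simp: a_def b_def)
  have D: "determinant_poly n a b = monom 1 (2 * m)"
    unfolding determinant_poly_def A B using n by (simp add: mult_monom a_def mult_2)
  have "monom 1 1 * (monom 1 (2 * m))\<^sup>2 = (monom 1 (4 * m + 1) :: complex poly)"
    "(monom 1 m)\<^sup>2 = (monom 1 (2 * m) :: complex poly)"
    by (simp_all add: mult_monom power2_eq_square flip: mult_2)
  then have G: "eliminant_poly n a b = monom 1 (4 * m + 1) - monom 1 (2 * m) - 1"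
    unfolding eliminant_poly_def u_numerator_def v_numerator_def A B D
    using n by (simp add: a_def b_def monom_0)
  show "degree (determinant_poly n a b) = 2 * (n - 1)"
    by (simp add: D degree_monom_eq m_def)
  have "degree (- monom (1::complex) (2 * m) - 1) \<le> 2 * m"
    by (intro degree_diff_le) (auto simp: degree_monom_eq)
  then have "degree (monom 1 (4 * m + 1) + (- monom (1::complex) (2 * m) - 1)) = 4 * m + 1"
    using m by (subst degree_add_eq_left) (auto simp: degree_monom_eq)
  then show "degree (eliminant_poly n a b) = 4 * n - 3"
    unfolding G diff_conv_add_uminus add.assoc using m by simp
  assume root: "poly (eliminant_poly n a b) z = 0"
  define w where "w = z ^ (2 * m)"
  have G0: "z ^ (4 * m + 1) - w = 1"
    using root by (simp add: G poly_monom w_def)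
  have z: "z \<noteq> 0"
    using G0 m by (auto simp: w_def power_0_left)
  have "poly (pderiv (eliminant_poly n a b)) z \<noteq> 0"
  proof
    assume "poly (pderiv (eliminant_poly n a b)) z = 0"
    then have "of_nat (4 * m + 1) * z ^ (4 * m) - of_nat (2 * m) * z ^ (2 * m - 1) = 0"
      by (simp add: G pderiv_diff pderiv_monom poly_monom)
    \<comment> \<open>Multiplication by \<open>z\<close> expresses the derivative by the two powers occurring in \<open>G\<close>.\<close>
    then have "(of_nat (4 * m + 1) * z ^ (4 * m) - of_nat (2 * m) * z ^ (2 * m - 1)) * z = 0"
      by simp
    moreover have "z ^ (2 * m - 1) * z = w"
      using m by (simp add: w_def flip: power_Suc2)
    ultimately have crit: "of_nat (4 * m + 1) * z ^ (4 * m + 1) = of_nat (2 * m) * w"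
      by (simp add: algebra_simps)
    have "z ^ (4 * m + 1) = 1 + w"
      using G0 by (simp only: diff_eq_eq)
    then have "of_nat (4 * m + 1) * (1 + w) = of_nat (2 * m) * w"
      using crit by simp
    moreover have "of_nat (2 * m + 1) * w + of_nat (4 * m + 1)
        = of_nat (4 * m + 1) * (1 + w) - of_nat (2 * m) * w"
      by (simp add: algebra_simps)
    ultimately have w_eq: "of_nat (2 * m + 1) * w = - of_nat (4 * m + 1)"
      by (simp only: eq_neg_iff_add_eq_0 diff_self)
    have "real (2 * m + 1) * norm w = real (4 * m + 1)"
      using arg_cong[OF w_eq, of norm] by (simp only: norm_mult norm_of_nat norm_minus_cancel)
    then have norm_w: "norm w = real (4 * m + 1) / real (2 * m + 1)"
      by (simp add: field_simps)
    have "real (4 * m + 1) * norm (z ^ (4 * m + 1)) = real (2 * m) * norm w"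
      using arg_cong[OF crit, of norm] by (simp only: norm_mult norm_of_nat)
    also have "\<dots> = real (4 * m + 1) * (real (2 * m) / real (2 * m + 1))"
      unfolding norm_w by (simp only: times_divide_eq_right mult.commute)
    finally have norm_z: "norm (z ^ (4 * m + 1)) = real (2 * m) / real (2 * m + 1)"
      unfolding mult_cancel_left of_nat_eq_0_iff by simp
    have "norm w > 1"
      unfolding norm_w using m by simp
    then have "norm z ^ (2 * m) > 1"
      by (simp only: w_def norm_power)
    then have "norm z > 1"
      using power_le_one[of "norm z" "2 * m"] by force
    moreover have "norm (z ^ (4 * m + 1)) < 1"
      unfolding norm_z by simp
    then have "norm z ^ (4 * m + 1) < 1"
      by (simp only: norm_power)
    ultimately show False
      using one_le_power[of "norm z" "4 * m + 1"] by simp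
  qed
  then show "poly (determinant_poly n a b) z \<noteq> 0 \<and> poly (pderiv (eliminant_poly n a b)) z \<noteq> 0"
    using z by (simp add: D poly_monom)
qed

lemma card_solutions_general_coefficients:
  assumes n: "n \<ge> 2"
  shows "holds_for_general (coefficients n)
    (\<lambda>c. card (solutions n (\<lambda>j. c (Coeff_a j)) (\<lambda>j. c (Coeff_b j))) = 4 * n - 3)"
proof -
  let ?a = "\<lambda>(c :: coefficient \<Rightarrow> complex) j. c (Coeff_a j)"
  let ?b = "\<lambda>(c :: coefficient \<Rightarrow> complex) j. c (Coeff_b j)"
  let ?G = "\<lambda>c. eliminant_poly n (?a c) (?b c)" and ?D = "\<lambda>c. determinant_poly n (?a c) (?b c)"
  have reg: "regular_function (coefficients n) (\<lambda>c. ?a c j)"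
    "regular_function (coefficients n) (\<lambda>c. ?b c j)" if "j \<le> n + 1" for j
    using that by (auto intro!: regular_function_coordinate simp: coefficients_def)
  have "n \<ge> 1" using n by simp
  obtain f where f: "regular_function (coefficients n) f"
    and f_iff: "\<And>c. f c \<noteq> 0 \<longleftrightarrow> degree (?G c) = 4 * n - 3 \<and> degree (?D c) = 2 * (n - 1) \<and>
      (\<forall>z. poly (?G c) z = 0 \<longrightarrow> poly (?D c) z \<noteq> 0 \<and> poly (pderiv (?G c)) z \<noteq> 0)"
  proof (rule generic_simple_roots_avoiding[of "coefficients n" ?G ?D "4 * n - 3" "2 * (n - 1)"])
    show "regular_family (coefficients n) ?G"
      by (rule regular_family_eliminant_poly[OF \<open>n \<ge> 1\<close> reg])
    show "regular_family (coefficients n) ?D"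
      by (rule regular_family_determinant_poly[OF \<open>n \<ge> 1\<close> reg])
    show "degree (?G c) \<le> 4 * n - 3" for c
      by (rule degree_eliminant_poly[OF \<open>n \<ge> 1\<close>])
    show "degree (?D c) \<le> 2 * (n - 1)" for c
      by (rule degree_determinant_poly)
    show "4 * n - 3 \<ge> 1"
      using n by simp
  qed (rule that)
  let ?y = "case_coefficient (\<lambda>j. if j = 0 \<or> j = n + 1 then 1 else 0)
    (\<lambda>j. if j = 1 \<or> j = n + 1 then 1 else 0) :: coefficient \<Rightarrow> complex"
  show ?thesis
  proof (rule holds_for_general_if_nonvanishing[OF f])
    show "f ?y \<noteq> 0"
      unfolding f_iff using eliminant_witness[OF n] by simp
    show "card (solutions n (?a c) (?b c)) = 4 * n - 3" if "f c \<noteq> 0" for c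
    proof -
      have *: "degree (?G c) = 4 * n - 3"
        "\<And>z. poly (?G c) z = 0 \<Longrightarrow> poly (?D c) z \<noteq> 0 \<and> poly (pderiv (?G c)) z \<noteq> 0"
        using that unfolding f_iff by blast+
      have "?G c \<noteq> 0" using *(1) n by auto
      then show ?thesis
        using card_solutions_eq_degree_eliminant[of n "?a c" "?b c"] * by simp
    qed
  qed
qed

section \<open>Harmonic Balance parameters\<close>

text \<open>With \<open>\<omega>\<^sub>0 = \<omega> = 1\<close>, \<open>\<lambda> = 8\<close>, \<open>\<gamma> = 2\<close> and only the top \<open>\<alpha>\<close> nonzero, the linear coefficients are
  \<open>a\<^sub>1 = -2\<close>, \<open>b\<^sub>2 = 2\<close>, \<open>a\<^sub>2 = 1\<close>, \<open>b\<^sub>1 = -1\<close>, so \<open>D = (c r\<^bsup>n-1\<^esup>)\<^sup>2 - 4 + 1\<close>. Its derivative vanishes at most at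
  \<open>0\<close>, where \<open>D\<close> is \<open>-3\<close>.\<close>

lemma harmonic_determinant_witness:
  fixes n :: nat
  assumes n: "n \<ge> 2"
  defines "y \<equiv> case_parameter 1 1 8 2 (\<lambda>k. if k = n - 1 then 1 else 0) :: parameter \<Rightarrow> complex"
  defines "D \<equiv> determinant_poly n (harmonic_a y) (harmonic_b y)"
  shows "degree D = 2 * (n - 1)"
    and "poly D z = 0 \<Longrightarrow> z \<noteq> 0 \<and> poly (pderiv D) z \<noteq> 0"
proof -
  define m where "m = n - 1"
  have m: "m \<ge> 1" "n = m + 1" using n by (auto simp: m_def)
  define c :: complex where "c = of_nat ((2 * m + 1) choose m) / 2 ^ (2 * m + 1)"
  have c: "c \<noteq> 0"
    unfolding c_def by simp
  have sum: "(\<Sum>k=1..n-1. monom (h (k + 2)) k) = monom c m"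
    if "\<And>k. k \<ge> 1 \<Longrightarrow> h (k + 2) = (if k = m then c else 0)" for h :: "nat \<Rightarrow> complex"
  proof -
    have "(\<Sum>k=1..n-1. monom (h (k + 2)) k) = (\<Sum>k=1..n-1. if k = m then monom c k else 0)"
      using m that by (intro sum.cong) auto
    then show ?thesis using m by simp
  qed
  have A: "amplitude_poly n 1 (harmonic_a y) = monom c m - [:2:]"
    unfolding amplitude_poly_def
    by (subst sum) (auto simp: harmonic_a_def y_def m_def c_def Let_def monom_0)
  have B: "amplitude_poly n 2 (harmonic_b y) = monom c m + [:2:]"
    unfolding amplitude_poly_def
    by (subst sum) (auto simp: harmonic_b_def y_def m_def c_def Let_def monom_0)
  have "D = (monom c m - [:2:]) * (monom c m + [:2:]) + [:1:]"
    unfolding D_def determinant_poly_def A B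
    by (simp add: harmonic_a_def harmonic_b_def y_def monom_0)
  also have "\<dots> = monom c m * monom c m - [:2:] * [:2:] + [:1:]"
    by (simp only: square_diff_square_factored mult.commute[of "monom c m - [:2:]"])
  also have "\<dots> = monom (c\<^sup>2) (2 * m) - ([:4:] - [:1:])"
    by (simp only: mult_monom power2_eq_square mult_2) simp
  also have "[:4:] - [:1:] = [:3 :: complex:]"
    unfolding diff_pCons by simp
  finally have D: "D = monom (c\<^sup>2) (2 * m) - [:3:]" .
  have "degree (monom (c\<^sup>2) (2 * m) + - [:3:]) = degree (monom (c\<^sup>2) (2 * m))"
    using m c by (intro degree_add_eq_left) (simp add: degree_monom_eq)
  then have "degree D = degree (monom (c\<^sup>2) (2 * m))"
    by (simp only: D diff_conv_add_uminus)
  then show "degree D = 2 * (n - 1)"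
    using c by (simp add: degree_monom_eq m_def)
  assume root: "poly D z = 0"
  then have z: "z \<noteq> 0" using m by (auto simp: D poly_monom power_0_left)
  then show "z \<noteq> 0 \<and> poly (pderiv D) z \<noteq> 0"
    using c m by (simp add: D pderiv_diff pderiv_monom pderiv_pCons poly_monom)
qed

lemma harmonic_amplitude_difference:
  "poly (amplitude_poly n 2 (harmonic_b p)) r - poly (amplitude_poly n 1 (harmonic_a p)) r
    = p Lambda * (p Omega0)\<^sup>2 / 2"
proof -
  have "(\<Sum>k=1..n-1. harmonic_b p (k + 2) * r ^ k) = (\<Sum>k=1..n-1. harmonic_a p (k + 2) * r ^ k)"
    by (intro sum.cong) (simp_all add: harmonic_a_def harmonic_b_def)
  then have "poly (amplitude_poly n 2 (harmonic_b p)) r - poly (amplitude_poly n 1 (harmonic_a p)) r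
      = harmonic_b p 2 - harmonic_a p 1"
    by (simp only: poly_amplitude_poly add_diff_cancel_right)
  then show ?thesis
    by (simp add: harmonic_a_def harmonic_b_def)
qed

text \<open>Applying the genericity lemma with \<open>h = r\<close> makes the roots of \<open>D\<close> nonzero as well as simple.
  The extra factor \<open>\<gamma> \<omega> \<lambda> \<omega>\<^sub>0\<^sup>2\<close> rules out isotropic kernels: put \<open>g = a\<^sub>2 = - b\<^sub>1\<close>. If both
  \<open>A B + g\<^sup>2 = 0\<close> and \<open>A\<^sup>2 + g\<^sup>2 = 0\<close>, then \<open>A (B - A) = 0\<close>; as \<open>B - A \<noteq> 0\<close>, this forces \<open>A = 0\<close>
  and hence \<open>g = 0\<close>.\<close>

lemma card_solutions_general_parameters:
  assumes n: "n \<ge> 2"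
  shows "holds_for_general (parameters n)
    (\<lambda>p. card (solutions n (harmonic_a p) (harmonic_b p)) = 4 * n - 3)"
proof -
  let ?D = "\<lambda>p. determinant_poly n (harmonic_a p) (harmonic_b p)"
  let ?X = "monom 1 1 :: complex poly"
  have alpha: "Alpha (j - 2) \<in> parameters n" if "j \<noteq> 0" "j \<noteq> 1" "j \<noteq> 2" "j \<le> n + 1" for j
  proof -
    have "j - 2 \<in> {1..n-1}" using that by auto
    then show ?thesis by (simp add: parameters_def)
  qed
  have params: "{Omega0, Omega, Lambda, Gamma} \<subseteq> parameters n"
    by (simp add: parameters_def)
  have reg: "regular_function (parameters n) (\<lambda>p. harmonic_a p j)"
    "regular_function (parameters n) (\<lambda>p. harmonic_b p j)" if "j \<le> n + 1" for j
    unfolding harmonic_a_def harmonic_b_def Let_def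
    using that params alpha[OF _ _ _ that]
    by (cases "j = 0"; cases "j = 1"; cases "j = 2"; auto intro!: regular_function_intros)+
  have "n \<ge> 1" using n by simp
  obtain f where f: "regular_function (parameters n) f"
    and f_iff: "\<And>p. f p \<noteq> 0 \<longleftrightarrow> degree (?D p) = 2 * (n - 1) \<and> degree ?X = 1 \<and>
      (\<forall>z. poly (?D p) z = 0 \<longrightarrow> poly ?X z \<noteq> 0 \<and> poly (pderiv (?D p)) z \<noteq> 0)"
  proof (rule generic_simple_roots_avoiding[of "parameters n" ?D "\<lambda>_. ?X" "2 * (n - 1)" 1])
    show "regular_family (parameters n) ?D"
      by (rule regular_family_determinant_poly[OF \<open>n \<ge> 1\<close> reg])
    show "regular_family (parameters n) (\<lambda>_. ?X)"
      by (rule regular_family_const_poly)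
    show "degree (?D p) \<le> 2 * (n - 1)" for p
      by (rule degree_determinant_poly)
    show "degree ?X \<le> 1"
      by (rule degree_monom_le)
    show "2 * (n - 1) \<ge> 1"
      using n by simp
  qed (rule that)
  let ?f = "\<lambda>p. f p * (p Gamma * p Omega * (p Lambda * (p Omega0)\<^sup>2))"
  let ?y = "case_parameter 1 1 8 2 (\<lambda>k. if k = n - 1 then 1 else 0) :: parameter \<Rightarrow> complex"
  show ?thesis
  proof (rule holds_for_general_if_nonvanishing)
    show "regular_function (parameters n) ?f"
      using params by (intro regular_function_intros f) auto
    have "f ?y \<noteq> 0"
      unfolding f_iff using harmonic_determinant_witness[OF n]
      by (simp add: poly_monom degree_monom_eq)
    then show "?f ?y \<noteq> 0" by simp
    show "card (solutions n (harmonic_a p) (harmonic_b p)) = 4 * n - 3" if nz: "?f p \<noteq> 0" for p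
    proof -
      let ?A = "poly (amplitude_poly n 1 (harmonic_a p))"
      let ?B = "poly (amplitude_poly n 2 (harmonic_b p))"
      let ?g = "p Gamma * p Omega / 2"
      have deg: "degree (?D p) = 2 * (n - 1)"
        and simple: "\<And>r. poly (?D p) r = 0 \<Longrightarrow> r \<noteq> 0 \<and> poly (pderiv (?D p)) r \<noteq> 0"
        using nz f_iff[of p] by (auto simp: poly_monom)
      have coeffs: "harmonic_a p 0 = 0" "harmonic_b p 0 = 0" "harmonic_a p 2 = ?g"
        "harmonic_b p 1 = - ?g"
        by (simp_all add: harmonic_a_def harmonic_b_def)
      have g: "?g \<noteq> 0" using nz by simp
      have "?D p \<noteq> 0" using deg n by auto
      moreover have "?g\<^sup>2 + (?A r)\<^sup>2 \<noteq> 0" if "poly (?D p) r = 0" for r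
      proof
        assume iso: "?g\<^sup>2 + (?A r)\<^sup>2 = 0"
        have AB: "?A r * ?B r + ?g * ?g = 0"
          using that unfolding determinant_poly_def poly_diff poly_mult coeffs
          by (simp add: poly_monom)
        have "?A r * (?B r - ?A r) = (?A r * ?B r + ?g * ?g) - (?g\<^sup>2 + (?A r)\<^sup>2)"
          by (simp add: power2_eq_square right_diff_distrib)
        then have "?A r * (?B r - ?A r) = 0"
          by (simp only: AB iso diff_self)
        moreover have "?B r - ?A r \<noteq> 0"
          unfolding harmonic_amplitude_difference using nz by simp
        ultimately have "?A r = 0" by simp
        then show False using AB g by simp
      qed
      ultimately have "card (solutions n (harmonic_a p) (harmonic_b p)) = 2 * degree (?D p) + 1"
        using simple g by (intro card_solutions_homogeneous) (auto simp: coeffs)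
      then show ?thesis using deg n by simp
    qed
  qed
qed

theorem theorem5p1:
  fixes n :: nat
  assumes "n \<ge> 2"
  shows "holds_for_general (coefficients n)
           (\<lambda>c. card (solutions n (\<lambda>j. c (Coeff_a j)) (\<lambda>j. c (Coeff_b j))) = 4 * n - 3)
       \<and> holds_for_general (parameters n)
           (\<lambda>p. card (solutions n (harmonic_a p) (harmonic_b p)) = 4 * n - 3)"
  using assms by (intro conjI card_solutions_general_coefficients card_solutions_general_parameters)

end
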